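(* Let $n\ge 3$. Any implicit center of $n$-gons is a minimal center, and vice versa. Moreover, any center associated to an $n$-gon center function $f$ (i.e. its geometric interpretation as a point of the plane) is an implicit center (and therefore a minimal center).
   Context: An $n$-gon is identified with a tuple $(V_1,\ldots,V_n)$ of points of $\mathbb R^2$ (its labelled vertices); $\mathcal P_n\approx(\mathbb R^2)^n$ is the set of all $n$-gons (the domain may be restricted, e.g. to non-degenerated $n$-gons, those with pairwise distinct vertices, or to the $n$-gons where the objects involved are defined). $D_n$ is the dihedral group of order $2n$ viewed as the group of permutations of $\{1,\ldots,n\}$ generated by $\rho(i)=i+1\bmod n$ and $\sigma(i)=2+n-i\bmod n$ (so $\sigma(1)=1$). Rigid motions are isometries of the plane. Implicit center. Let $F(P,V_1,\ldots,V_n)$ be a map (with values in, e.g., $\mathbb R$ or $\mathbb R^2$), $P\in\mathbb R^2$, such that: (a) for every $(V_1,\ldots,V_n)\in\mathcal P_n$, $F(P,V_1,\ldots,V_n)=0$ defines $P$ uniquely; (b) if $F(P,V_1,\ldots,V_n)=0$ then $F(P,V_{\alpha(1)},\ldots,V_{\alpha(n)})=0$ for every $\alpha\in D_n$; (c) for every $\lambda\in\mathbb R_{\ge0}$, $F(P,V_1,\ldots,V_n)=0\Rightarrow F(\lambda P,\lambda V_1,\ldots,\lambda V_n)=0$; (d) for every rigid motion $T$, $F(P,V_1,\ldots,V_n)=0\Rightarrow F(T(P),T(V_1),\ldots,T(V_n))=0$. The point $P$ given by (a) is called an implicit center of $(V_1,\ldots,V_n)$. Minimal center. Let $G(P,V_1,\ldots,V_n)$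 be a real function, $P\in\mathbb R^2$, such that: (a') for every $(V_1,\ldots,V_n)\in\mathcal P_n$ there exists a unique $X(V_1,\ldots,V_n)=\arg\min_{P\in\mathbb R^2}G(P,V_1,\ldots,V_n)$; (b') $X(V_1,\ldots,V_n)=X(V_{\alpha(1)},\ldots,V_{\alpha(n)})$ for every $\alpha\in D_n$; (c') $\lambda\cdot X(V_1,\ldots,V_n)=X(\lambda V_1,\ldots,\lambda V_n)$ for every $\lambda\in\mathbb R_{\ge0}$; (d') $T(X(V_1,\ldots,V_n))=X(T(V_1),\ldots,T(V_n))$ for every rigid motion $T$. The point $X(V_1,\ldots,V_n)$ is called a minimal center of $(V_1,\ldots,V_n)$. To say that a center of one kind is of another kind means that the same assignment of a point to each $n$-gon arises from data of the other kind. Center associated to a center function. An $n$-gon center function is a real-valued function $f(V_1,\ldots,V_n)$ such that: (1) $f(V_1,V_2,\ldots,V_n)=f(V_1,V_{\sigma(2)},\ldots,V_{\sigma(n)})$; (2) there is $k\in\mathbb N$ (with $0\in\mathbb N$) such that $f(tV_1,\ldots,tV_n)=t^kf(V_1,\ldots,V_n)$ for all $t\in\mathbb R_{\ge 0}$; (3) $f(T(V_1),\ldots,T(V_n))=f(V_1,\ldots,V_n)$ for every rigid motion $T$ (for $n$-gons in the domain). Its coordinate map is $\varphi_f(V_1,\ldots,V_n)=[f(V_1,\ldots,V_n):f(V_2,\ldots,V_n,V_1):\ldots:f(V_n,V_1,\ldots,V_{n-1})]\in P_{n-1}\mathbb R$ (undefined if all entries vanish). The center (geometric interpretation) associated to $f$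 is the point $\widetilde f(V_1,\ldots,V_n)V_1+\widetilde f(V_2,\ldots,V_n,V_1)V_2+\ldots+\widetilde f(V_n,V_1,\ldots,V_{n-1})V_n$, where the $\widetilde f$-values are the representative of $\varphi_f(V_1,\ldots,V_n)$ normalized to have sum $1$. In the second assertion, the conditions (a)–(d) are understood on the set of $n$-gons for which this point is defined. *)

theory Defs
  imports "HOL-Analysis.Analysis" "HOL-Algebra.Sym_Groups" "HOL-Algebra.Generated_Groups"
begin

type_synonym point = "real^2"

text \<open>An $n$-gon is an extensional function on $\{1,\ldots,n\}$; its value at \<open>i\<close> is the vertex $V_i$.\<close>
type_synonym ngon = "nat \<Rightarrow> point"

definition ngons :: "nat \<Rightarrow> ngon set" where
  "ngons n = {1..n} \<rightarrow>\<^sub>E UNIV"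

text \<open>The generators $i \mapsto i + 1$ and $i \mapsto 2 + n - i$ of the dihedral group, with the
  representatives modulo \<open>n\<close> taken in $\{1,\ldots,n\}$, extended by the identity outside that set.\<close>

definition rho :: "nat \<Rightarrow> nat \<Rightarrow> nat" where
  "rho n i = (if i \<in> {1..n} then i mod n + 1 else i)"

definition sigma :: "nat \<Rightarrow> nat \<Rightarrow> nat" where
  "sigma n i = (if i \<in> {1..n} then (n + 1 - i) mod n + 1 else i)"

definition dihedral :: "nat \<Rightarrow> (nat \<Rightarrow> nat) set" where
  "dihedral n = generate (sym_group n) {rho n, sigma n}"

definition relabel :: "nat \<Rightarrow> (nat \<Rightarrow> nat) \<Rightarrow> ngon \<Rightarrow> ngon" where
  "relabel n \<alpha> V = (\<lambda>i\<in>{1..n}. V (\<alpha> i))"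

definition map_ngon :: "nat \<Rightarrow> (point \<Rightarrow> point) \<Rightarrow> ngon \<Rightarrow> ngon" where
  "map_ngon n T V = (\<lambda>i\<in>{1..n}. T (V i))"

definition scale_ngon :: "nat \<Rightarrow> real \<Rightarrow> ngon \<Rightarrow> ngon" where
  "scale_ngon n t V = map_ngon n (\<lambda>x. t *\<^sub>R x) V"

text \<open>Orientation-reversing isometries are included; surjectivity is automatic in finite dimension.\<close>
definition rigid_motion :: "(point \<Rightarrow> point) \<Rightarrow> bool" where
  "rigid_motion T \<longleftrightarrow> (\<forall>x y. dist (T x) (T y) = dist x y)"

text \<open>Below, \<open>D\<close> is the domain, an arbitrary set of $n$-gons. Every condition that compares an
  $n$-gon with a transformed one is imposed when both lie in \<open>D\<close>: for instance, scaling by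
  \<open>0\<close> leaves the set of $n$-gons with pairwise distinct vertices. For \<open>D = ngons n\<close> these guards hold
  automatically.\<close>

definition implicit_center_data ::
  "nat \<Rightarrow> ngon set \<Rightarrow> (point \<Rightarrow> ngon \<Rightarrow> 'b::zero) \<Rightarrow> bool" where
  "implicit_center_data n D F \<longleftrightarrow>
     (\<forall>V\<in>D. \<exists>!P. F P V = 0) \<and>
     (\<forall>V\<in>D. \<forall>P. \<forall>\<alpha>\<in>dihedral n. relabel n \<alpha> V \<in> D \<longrightarrow>
        F P V = 0 \<longrightarrow> F P (relabel n \<alpha> V) = 0) \<and>
     (\<forall>V\<in>D. \<forall>P. \<forall>t\<ge>0. scale_ngon n t V \<in> D \<longrightarrow>
        F P V = 0 \<longrightarrow> F (t *\<^sub>R P) (scale_ngon n t V) = 0) \<and>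
     (\<forall>V\<in>D. \<forall>P T. rigid_motion T \<longrightarrow> map_ngon n T V \<in> D \<longrightarrow>
        F P V = 0 \<longrightarrow> F (T P) (map_ngon n T V) = 0)"

text \<open>\<open>X\<close> is the assignment of a point to each $n$-gon in \<open>D\<close>; the type argument is the codomain
  of the defining map \<open>F\<close>.\<close>
definition implicit_center ::
  "'b::zero itself \<Rightarrow> nat \<Rightarrow> ngon set \<Rightarrow> (ngon \<Rightarrow> point) \<Rightarrow> bool" where
  "implicit_center (_ :: 'b itself) n D X \<longleftrightarrow>
     (\<exists>F :: point \<Rightarrow> ngon \<Rightarrow> 'b. implicit_center_data n D F \<and> (\<forall>V\<in>D. F (X V) V = 0))"

definition minimizer :: "(point \<Rightarrow> ngon \<Rightarrow> real) \<Rightarrow> ngon \<Rightarrow> point" where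
  "minimizer G V = (ARG_MIN (\<lambda>P. G P V) P. True)"

definition minimal_center_data ::
  "nat \<Rightarrow> ngon set \<Rightarrow> (point \<Rightarrow> ngon \<Rightarrow> real) \<Rightarrow> bool" where
  "minimal_center_data n D G \<longleftrightarrow>
     (\<forall>V\<in>D. \<exists>!P. is_arg_min (\<lambda>P. G P V) (\<lambda>_. True) P) \<and>
     (\<forall>V\<in>D. \<forall>\<alpha>\<in>dihedral n. relabel n \<alpha> V \<in> D \<longrightarrow>
        minimizer G V = minimizer G (relabel n \<alpha> V)) \<and>
     (\<forall>V\<in>D. \<forall>t\<ge>0. scale_ngon n t V \<in> D \<longrightarrow>
        t *\<^sub>R minimizer G V = minimizer G (scale_ngon n t V)) \<and>
     (\<forall>V\<in>D. \<forall>T. rigid_motion T \<longrightarrow> map_ngon n T V \<in> D \<longrightarrow>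
        T (minimizer G V) = minimizer G (map_ngon n T V))"

definition minimal_center :: "nat \<Rightarrow> ngon set \<Rightarrow> (ngon \<Rightarrow> point) \<Rightarrow> bool" where
  "minimal_center n D X \<longleftrightarrow>
     (\<exists>G. minimal_center_data n D G \<and> (\<forall>V\<in>D. X V = minimizer G V))"

definition center_function :: "nat \<Rightarrow> ngon set \<Rightarrow> (ngon \<Rightarrow> real) \<Rightarrow> bool" where
  "center_function n D f \<longleftrightarrow>
     (\<forall>V\<in>D. relabel n (sigma n) V \<in> D \<longrightarrow> f V = f (relabel n (sigma n) V)) \<and>
     (\<exists>k::nat. \<forall>V\<in>D. \<forall>t\<ge>0. scale_ngon n t V \<in> D \<longrightarrow> f (scale_ngon n t V) = t ^ k * f V) \<and>
     (\<forall>V\<in>D. \<forall>T. rigid_motion T \<longrightarrow> map_ngon n T V \<in> D \<longrightarrow> f (map_ngon n T V) = f V)"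

text \<open>The $n$-gon $(V_j,\ldots,V_n,V_1,\ldots,V_{j-1})$.\<close>
definition shifted :: "nat \<Rightarrow> nat \<Rightarrow> ngon \<Rightarrow> ngon" where
  "shifted n j V = relabel n (rho n ^^ (j - 1)) V"

text \<open>The point of projective space with the given homogeneous coordinates, as the set of all
  its representatives; \<open>None\<close> if all coordinates vanish.\<close>
definition proj_point :: "nat \<Rightarrow> (nat \<Rightarrow> real) \<Rightarrow> (nat \<Rightarrow> real) set option" where
  "proj_point n u =
     (if \<forall>j\<in>{1..n}. u j = 0 then None
      else Some {\<lambda>j\<in>{1..n}. c * u j | c. c \<noteq> 0})"

definition coordinate_map :: "nat \<Rightarrow> (ngon \<Rightarrow> real) \<Rightarrow> ngon \<Rightarrow> (nat \<Rightarrow> real) set option" where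
  "coordinate_map n f V = proj_point n (\<lambda>j. f (shifted n j V))"

definition normalized_rep :: "nat \<Rightarrow> (nat \<Rightarrow> real) set \<Rightarrow> (nat \<Rightarrow> real) \<Rightarrow> bool" where
  "normalized_rep n p w \<longleftrightarrow> w \<in> p \<and> (\<Sum>j=1..n. w j) = 1"

text \<open>The $n$-gons for which the center associated to \<open>f\<close> is defined, where \<open>D\<close> is the domain
  of \<open>f\<close>: \<open>f\<close> is defined at all cyclic shifts, the coordinate map is defined, and
  its value can be normalized (its coordinate sum is nonzero).\<close>
definition associated_center_domain :: "nat \<Rightarrow> ngon set \<Rightarrow> (ngon \<Rightarrow> real) \<Rightarrow> ngon set" where
  "associated_center_domain n D f =
     {V \<in> ngons n. (\<forall>j\<in>{1..n}. shifted n j V \<in> D) \<and>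
        (\<exists>p w. coordinate_map n f V = Some p \<and> normalized_rep n p w)}"

definition associated_center :: "nat \<Rightarrow> (ngon \<Rightarrow> real) \<Rightarrow> ngon \<Rightarrow> point" where
  "associated_center n f V =
     (let w = (THE w. normalized_rep n (the (coordinate_map n f V)) w)
      in \<Sum>j=1..n. w j *\<^sub>R V j)"

end

theory Submission
  imports Defs
begin

text \<open>Each kind of center is the same as an assignment of points that is equivariant under
  relabelling, scaling and rigid motions: such an \<open>X\<close> is cut out by the distance of \<open>P\<close> to
  \<open>X V\<close>, which vanishes, and is minimal, exactly at \<open>P = X V\<close>. The center associated to a
  center function is equivariant since its homogeneous coordinates are permuted by
  relabellings, rescaled by a common factor under scaling and fixed by rigid motions, which
  are affine maps.\<close>

section \<open>Equivariant point assignments and the two kinds of center\<close>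

definition equivariant_center :: "nat \<Rightarrow> ngon set \<Rightarrow> (ngon \<Rightarrow> point) \<Rightarrow> bool" where
  "equivariant_center n D X \<longleftrightarrow>
     (\<forall>V\<in>D. \<forall>\<alpha>\<in>dihedral n. relabel n \<alpha> V \<in> D \<longrightarrow> X (relabel n \<alpha> V) = X V) \<and>
     (\<forall>V\<in>D. \<forall>t\<ge>0. scale_ngon n t V \<in> D \<longrightarrow> X (scale_ngon n t V) = t *\<^sub>R X V) \<and>
     (\<forall>V\<in>D. \<forall>T. rigid_motion T \<longrightarrow> map_ngon n T V \<in> D \<longrightarrow> X (map_ngon n T V) = T (X V))"

text \<open>By uniqueness of the zero, an equation \<open>X W = P\<close> with \<open>W\<close> in
  \<open>D\<close> reduces to \<open>F P W = 0\<close>, so each equivariance law follows from the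
  condition that carries zeros of \<open>F\<close> to zeros.\<close>

lemma implicit_center_imp_equivariant:
  assumes "implicit_center TYPE('a::zero) n D X"
  shows "equivariant_center n D X"
proof -
  obtain F :: "point \<Rightarrow> ngon \<Rightarrow> 'a"
    where F: "implicit_center_data n D F" and X: "\<And>V. V \<in> D \<Longrightarrow> F (X V) V = 0"
    using assms unfolding implicit_center_def by auto
  have unique: "X V = P" if "V \<in> D" "F P V = 0" for V P
    using F X[OF that(1)] that unfolding implicit_center_data_def by metis
  show ?thesis
    unfolding equivariant_center_def
  proof (intro conjI ballI allI impI unique)
    fix V \<alpha> assume "V \<in> D" "\<alpha> \<in> dihedral n" "relabel n \<alpha> V \<in> D"
    then show "F (X V) (relabel n \<alpha> V) = 0"
      using F X unfolding implicit_center_data_def by metis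
  next
    fix V and t :: real assume "V \<in> D" "t \<ge> 0" "scale_ngon n t V \<in> D"
    then show "F (t *\<^sub>R X V) (scale_ngon n t V) = 0"
      using F X unfolding implicit_center_data_def by metis
  next
    fix V T assume "V \<in> D" "rigid_motion T" "map_ngon n T V \<in> D"
    then show "F (T (X V)) (map_ngon n T V) = 0"
      using F X unfolding implicit_center_data_def by metis
  qed
qed

lemma equivariant_imp_implicit_center:
  assumes "equivariant_center n D X"
  shows "implicit_center TYPE('b::euclidean_space) n D X"
proof -
  \<comment> \<open>A fixed nonzero vector carries the distance into the codomain, so that one
    \<open>F\<close> serves real and vector values alike.\<close>
  obtain b :: 'b where b: "b \<in> Basis"
    using nonempty_Basis by blast
  define F where "F = (\<lambda>P V. dist P (X V) *\<^sub>R b)"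
  have F: "F P V = 0 \<longleftrightarrow> P = X V" for P V
    using b by (auto simp: F_def)
  have "implicit_center_data n D F"
    using assms by (simp add: implicit_center_data_def equivariant_center_def F)
  then show ?thesis
    unfolding implicit_center_def by (intro exI[of _ F]) (simp add: F)
qed

lemma minimal_center_imp_equivariant:
  assumes "minimal_center n D X"
  shows "equivariant_center n D X"
proof -
  obtain G where "minimal_center_data n D G" "\<And>V. V \<in> D \<Longrightarrow> X V = minimizer G V"
    using assms unfolding minimal_center_def by auto
  then show ?thesis
    by (simp add: minimal_center_data_def equivariant_center_def)
qed

lemma equivariant_imp_minimal_center:
  assumes "equivariant_center n D X"
  shows "minimal_center n D X"
proof -
  define G where "G = (\<lambda>P V. dist P (X V))"
  have arg_min: "is_arg_min (\<lambda>P. G P V) (\<lambda>_. True) P \<longleftrightarrow> P = X V" for P V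
    unfolding is_arg_min_def G_def
    by (metis dist_eq_0_iff not_less zero_le_dist zero_less_dist_iff)
  \<comment> \<open>\<open>arg_min\<close> is a Hilbert choice; by \<open>arg_min\<close> above it
    chooses from the single point \<open>X V\<close>.\<close>
  have minimizer: "minimizer G V = X V" for V
    unfolding minimizer_def arg_min_def arg_min by simp
  have "minimal_center_data n D G"
    using assms by (simp add: minimal_center_data_def equivariant_center_def arg_min minimizer)
  then show ?thesis
    unfolding minimal_center_def by (intro exI[of _ G]) (simp add: minimizer)
qed

section \<open>Rotations, the reflection and the dihedral group\<close>

text \<open>Vertices are numbered from 1, so rotation is addition on the residue
  \<open>i - 1\<close>; the subtraction does not truncate as \<open>i\<close> is at least 1.\<close>

lemma rho_funpow_apply:
  assumes "i \<in> {1..n}"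
  shows "(rho n ^^ m) i = (i - 1 + m) mod n + 1"
proof (induction m)
  case 0
  then show ?case using assms by auto
next
  case (Suc m)
  have "(i - 1 + m) mod n < n"
    using assms by auto
  then show ?case
    using Suc by (simp add: rho_def mod_simps)
qed

lemma rho_funpow_outside: "i \<notin> {1..n} \<Longrightarrow> (rho n ^^ m) i = i"
  by (induction m) (auto simp: rho_def simp del: atLeastAtMost_iff)

lemma rho_funpow_self: "rho n ^^ n = id"
proof
  fix i show "(rho n ^^ n) i = id i"
  proof (cases "i \<in> {1..n}")
    case True
    then have "(i - 1 + n) mod n = i - 1"
      by (simp only: mod_add_self2) auto
    with True show ?thesis
      by (simp only: rho_funpow_apply) simp
  qed (simp add: rho_funpow_outside)
qed

lemma rho_permutes: "rho n permutes {1..n}"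
proof (rule bij_imp_permutes)
  have "inj_on (rho n) {1..n}"
  proof (rule inj_onI)
    fix i j
    assume "i \<in> {1..n}" "j \<in> {1..n}" "rho n i = rho n j"
    then show "i = j"
      by (cases "i = n"; cases "j = n") (auto simp: rho_def)
  qed
  moreover have "rho n ` {1..n} \<subseteq> {1..n}"
    by (auto simp: rho_def Suc_le_eq)
  ultimately show "bij_betw (rho n) {1..n} {1..n}"
    by (simp add: bij_betw_def endo_inj_surj)
qed (auto simp: rho_def)

lemma sigma_mem: "i \<in> {1..n} \<Longrightarrow> sigma n i \<in> {1..n}"
  by (auto simp: sigma_def Suc_le_eq)

lemma sigma_sigma: "sigma n (sigma n i) = i"
proof (cases "i \<in> {1..n}")
  case True
  show ?thesis
  \<comment> \<open>Within the index range, only at 1 does \<open>n + 1 - i\<close> reach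
    \<open>n\<close> and wrap around to 0.\<close>
  proof (cases "i = 1")
    case False
    then have "(n + 1 - i) mod n = n + 1 - i"
      using True by (intro mod_less) auto
    then show ?thesis
      using True False by (auto simp: sigma_def)
  qed (use True in \<open>auto simp: sigma_def\<close>)
qed (auto simp: sigma_def)

lemma sigma_permutes: "sigma n permutes {1..n}"
proof (rule bij_imp_permutes)
  show "bij_betw (sigma n) {1..n} {1..n}"
    by (rule bij_betw_byWitness[where f' = "sigma n"])
      (use sigma_sigma sigma_mem in blast)+
qed (auto simp: sigma_def)

text \<open>One more rotation raises the exponent to \<open>j\<close>; at \<open>j = n\<close> it
  has to wrap to 0, which is where \<open>rho n ^^ n = id\<close> enters.\<close>

lemma rho_comp_funpow:
  assumes "j \<in> {1..n}"
  shows "rho n \<circ> rho n ^^ (j - 1) = rho n ^^ (rho n j - 1)"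
proof -
  have "rho n \<circ> rho n ^^ (j - 1) = rho n ^^ j"
    using assms by (cases j) auto
  also have "\<dots> = rho n ^^ (j mod n)"
    by (rule ext) (simp add: funpow_mod_eq rho_funpow_self)
  finally show ?thesis
    using assms by (simp add: rho_def)
qed

text \<open>This is the dihedral relation that a reflection inverts rotations:
  \<open>sigma n j - 1\<close> is the residue of \<open>-(j - 1)\<close>, and in residues counted
  from 0 both sides send \<open>i\<close> to \<open>-(i - 1) - (j - 1)\<close>.\<close>

lemma sigma_comp_rho_funpow:
  assumes "j \<in> {1..n}"
  shows "sigma n \<circ> rho n ^^ (j - 1) = rho n ^^ (sigma n j - 1) \<circ> sigma n"
proof
  fix i
  show "(sigma n \<circ> rho n ^^ (j - 1)) i = (rho n ^^ (sigma n j - 1) \<circ> sigma n) i"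
  proof (cases "i \<in> {1..n}")
    case True
    define a where "a = (i - 1 + (j - 1)) mod n"
    have "a < n"
      using True by (auto simp: a_def)
    \<comment> \<open>The residue of the left-hand side is \<open>(n - a) mod n\<close>. Integers
      are used because negated residues would truncate on the naturals.\<close>
    have "int ((n - a) mod n) = (- int a) mod int n"
      using \<open>a < n\<close> by (simp add: of_nat_diff zmod_int)
    also have "\<dots> = (- (int i - 1 + (int j - 1))) mod int n"
      using True assms by (simp add: a_def zmod_int of_nat_diff mod_minus_eq)
    also have "\<dots> = (int (n + 1 - i) + int (n + 1 - j)) mod int n"
    proof -
      have "int (n + 1 - i) + int (n + 1 - j) = - (int i - 1 + (int j - 1)) + 2 * int n"
        using True assms by (simp add: of_nat_diff)
      then show ?thesis
        by (simp only: mod_mult_self1)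
    qed
    also have "\<dots> = int (((n + 1 - i) mod n + (n + 1 - j) mod n) mod n)"
      by (simp only: mod_add_eq flip: zmod_int of_nat_add)
    finally have "(n - a) mod n = ((n + 1 - i) mod n + (n + 1 - j) mod n) mod n"
      by (simp only: of_nat_eq_iff)
    moreover have "(rho n ^^ (j - 1)) i = a + 1"
      using True by (simp add: rho_funpow_apply a_def)
    moreover have "sigma n i \<in> {1..n}"
      using True by (rule sigma_mem)
    moreover have "a + 1 \<in> {1..n}"
      using \<open>a < n\<close> by simp
    ultimately show ?thesis
      using True assms by (simp add: rho_funpow_apply sigma_def del: atLeastAtMost_iff)
  next
    case False
    then have "sigma n i = i"
      by (auto simp: sigma_def)
    with False show ?thesis
      by (simp add: rho_funpow_outside)
  qed
qed

text \<open>\<open>rho n ^^ (j - 1)\<close> is the rotation taking 1 to \<open>j\<close>. Following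
  it by \<alpha> takes 1 to \<open>\<alpha> j\<close>, so what remains beside the rotation to
  \<open>\<alpha> j\<close> fixes 1, hence is the identity or the reflection. These are the
  relabellings under which a center function is invariant.\<close>

lemma dihedral_comp_rho_funpow:
  assumes "\<alpha> \<in> dihedral n"
  shows "\<alpha> permutes {1..n} \<and>
    (\<exists>\<tau>\<in>{id, sigma n}. \<forall>j\<in>{1..n}. \<alpha> \<circ> rho n ^^ (j - 1) = rho n ^^ (\<alpha> j - 1) \<circ> \<tau>)"
    (is "?P \<alpha>")
proof -
  have "?P (rho n)"
    using rho_permutes rho_comp_funpow by (metis comp_id insertI1)
  moreover have "?P (sigma n)"
    using sigma_permutes sigma_comp_rho_funpow by blast
  ultimately have generator: "?P h" if "h \<in> {rho n, sigma n}" for h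
    using that by blast
  have involution: "\<tau> \<circ> \<tau> = id" if "\<tau> \<in> {id, sigma n}" for \<tau>
    using that by (auto simp: fun_eq_iff sigma_sigma)
  show ?thesis
    using assms unfolding dihedral_def
  proof (induction rule: generate.induct)
    case one
    then show ?case
      by (simp add: sym_group_one) (simp add: id_def permutes_def)
  next
    case (incl h)
    then show ?case
      by (rule generator)
  next
    case (inv h)
    obtain \<tau> where h: "h permutes {1..n}" and \<tau>: "\<tau> \<in> {id, sigma n}"
      and comp: "\<And>j. j \<in> {1..n} \<Longrightarrow> h \<circ> rho n ^^ (j - 1) = rho n ^^ (h j - 1) \<circ> \<tau>"
      using generator[OF inv] by blast
    let ?g = "inv_into UNIV h"
    have g: "?g permutes {1..n}"
      using h by (rule permutes_inv)
    have "?g \<circ> rho n ^^ (j - 1) = rho n ^^ (?g j - 1) \<circ> \<tau>" if "j \<in> {1..n}" for j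
    proof -
      \<comment> \<open>The relation for \<open>h\<close> is taken at \<open>?g j\<close>, which
        \<open>h\<close> sends to \<open>j\<close>; composing with \<open>?g\<close> on the left and
        the involution \<tau> on the right inverts it.\<close>
      have "rho n ^^ (j - 1) \<circ> \<tau> = h \<circ> rho n ^^ (?g j - 1)"
        using comp[of "?g j"] that g h permutes_in_image[OF g] by (simp add: permutes_inverses)
      then have "?g \<circ> (rho n ^^ (j - 1) \<circ> \<tau>) \<circ> \<tau> = ?g \<circ> (h \<circ> rho n ^^ (?g j - 1)) \<circ> \<tau>"
        by (simp only:)
      then have "?g \<circ> rho n ^^ (j - 1) \<circ> (\<tau> \<circ> \<tau>) = (?g \<circ> h) \<circ> rho n ^^ (?g j - 1) \<circ> \<tau>"
        by (simp only: comp_assoc)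
      then show ?thesis
        by (simp add: involution[OF \<tau>] permutes_inv_o[OF h])
    qed
    with g \<tau> have "?P ?g"
      by blast
    moreover have "inv\<^bsub>sym_group n\<^esub> h = ?g"
      using h by (simp add: sym_group_inv_equality sym_group_carrier)
    ultimately show ?case
      by simp
  next
    case (eng h1 h2)
    obtain \<tau>1 where h1: "h1 permutes {1..n}" and \<tau>1: "\<tau>1 \<in> {id, sigma n}"
      and comp1: "\<And>j. j \<in> {1..n} \<Longrightarrow> h1 \<circ> rho n ^^ (j - 1) = rho n ^^ (h1 j - 1) \<circ> \<tau>1"
      using eng by blast
    obtain \<tau>2 where h2: "h2 permutes {1..n}" and \<tau>2: "\<tau>2 \<in> {id, sigma n}"
      and comp2: "\<And>j. j \<in> {1..n} \<Longrightarrow> h2 \<circ> rho n ^^ (j - 1) = rho n ^^ (h2 j - 1) \<circ> \<tau>2"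
      using eng by blast
    \<comment> \<open>Moving \<open>h2\<close> past the rotation leaves the rotation to
      \<open>h2 j\<close>, past which \<open>h1\<close> is moved next; the leftover reflections
      multiply.\<close>
    have "(h1 \<circ> h2) \<circ> rho n ^^ (j - 1) = rho n ^^ ((h1 \<circ> h2) j - 1) \<circ> (\<tau>1 \<circ> \<tau>2)"
      if "j \<in> {1..n}" for j
    proof -
      have "h2 j \<in> {1..n}"
        using that permutes_in_image[OF h2] by blast
      then show ?thesis
        using comp1[of "h2 j"] comp2[OF that] by (simp add: comp_assoc) (metis comp_assoc)
    qed
    moreover have "\<tau>1 \<circ> \<tau>2 \<in> {id, sigma n}"
      using \<tau>1 \<tau>2 involution[of "sigma n"] by auto
    ultimately have "?P (h1 \<circ> h2)"
      using permutes_compose[OF h2 h1] by blast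
    then show ?case
      by (simp add: sym_group_mult)
  qed
qed

section \<open>The associated center and its equivariance\<close>

lemma relabel_apply: "i \<in> {1..n} \<Longrightarrow> relabel n \<alpha> V i = V (\<alpha> i)"
  by (simp add: relabel_def)

lemma map_ngon_apply: "i \<in> {1..n} \<Longrightarrow> map_ngon n T V i = T (V i)"
  by (simp add: map_ngon_def)

text \<open>Relabelling is precomposition, hence a right action. The hypothesis keeps the inner
  n-gon from being evaluated where it is \<open>undefined\<close>.\<close>

lemma relabel_relabel:
  assumes "\<And>i. i \<in> {1..n} \<Longrightarrow> \<beta> i \<in> {1..n}"
  shows "relabel n \<beta> (relabel n \<alpha> V) = relabel n (\<alpha> \<circ> \<beta>) V"
  using assms by (auto simp: relabel_def fun_eq_iff simp del: atLeastAtMost_iff)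

lemma rho_funpow_mem: "i \<in> {1..n} \<Longrightarrow> (rho n ^^ m) i \<in> {1..n}"
  by (auto simp: rho_funpow_apply Suc_le_eq)

lemma shifted_map_ngon: "shifted n j (map_ngon n T V) = map_ngon n T (shifted n j V)"
  using rho_funpow_mem[of _ n "j - 1"]
  by (auto simp: shifted_def relabel_def map_ngon_def fun_eq_iff simp del: atLeastAtMost_iff)

text \<open>A representative with factor \<open>c\<close> has sum \<open>c * ?S\<close>. Sum 1
  forces \<open>?S\<close> to be nonzero and \<open>c\<close> to be its inverse, which determines
  the definite description. Later arguments can then compare unnormalized coordinates.\<close>

lemma associated_center_eq:
  assumes "V \<in> associated_center_domain n D f"
  shows "(\<Sum>j=1..n. f (shifted n j V)) \<noteq> 0"
    and "associated_center n f V =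
      (\<Sum>j=1..n. f (shifted n j V) *\<^sub>R V j) /\<^sub>R (\<Sum>j=1..n. f (shifted n j V))"
proof -
  let ?u = "\<lambda>j. f (shifted n j V)"
  let ?S = "\<Sum>j=1..n. ?u j"
  obtain p w0 where p: "coordinate_map n f V = Some p" and w0: "normalized_rep n p w0"
    using assms unfolding associated_center_domain_def by blast
  have p_eq: "p = {\<lambda>j\<in>{1..n}. c * ?u j | c. c \<noteq> 0}"
    using p unfolding coordinate_map_def proj_point_def by (auto split: if_splits)
  have rep: "\<exists>c. w = (\<lambda>j\<in>{1..n}. c * ?u j) \<and> c * ?S = 1" if w: "normalized_rep n p w" for w
  proof -
    obtain c where "w = (\<lambda>j\<in>{1..n}. c * ?u j)"
      using w unfolding normalized_rep_def p_eq by blast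
    moreover from this have "(\<Sum>j=1..n. w j) = c * ?S"
      by (simp add: sum_distrib_left)
    ultimately show ?thesis
      using w unfolding normalized_rep_def by auto
  qed
  show S: "?S \<noteq> 0"
    using rep[OF w0] by auto
  have unique: "w = (\<lambda>j\<in>{1..n}. inverse ?S * ?u j)" if w: "normalized_rep n p w" for w
  proof -
    obtain c where "w = (\<lambda>j\<in>{1..n}. c * ?u j)" "c * ?S = 1"
      using rep[OF w] by blast
    moreover from this have "inverse ?S = c"
      using S by (simp add: field_simps)
    ultimately show ?thesis
      by simp
  qed
  have "(THE w. normalized_rep n (the (coordinate_map n f V)) w) = (\<lambda>j\<in>{1..n}. inverse ?S * ?u j)"
    using unique w0 unfolding p by (metis (no_types, lifting) option.sel the_equality)
  then show "associated_center n f V = (\<Sum>j=1..n. ?u j *\<^sub>R V j) /\<^sub>R ?S"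
    by (simp add: associated_center_def scaleR_sum_right)
qed

text \<open>An isometry fixing the origin is linear, which applies after subtracting
  \<open>T 0\<close>; weights of sum 1 subtract \<open>T 0\<close> exactly once in total.\<close>

lemma rigid_motion_affine:
  assumes T: "rigid_motion T" and w: "(\<Sum>j\<in>A. w j) = 1"
  shows "T (\<Sum>j\<in>A. w j *\<^sub>R V j) = (\<Sum>j\<in>A. w j *\<^sub>R T (V j))"
proof -
  define L where "L = (\<lambda>x. T x - T 0)"
  have "orthogonal_transformation L"
    unfolding orthogonal_transformation_isometry
    using T by (simp add: L_def rigid_motion_def dist_norm)
  then have "linear L"
    by (rule orthogonal_transformation_linear)
  then have "L (\<Sum>j\<in>A. w j *\<^sub>R V j) = (\<Sum>j\<in>A. w j *\<^sub>R L (V j))"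
    by (simp add: linear_sum linear_cmul)
  also have "\<dots> = (\<Sum>j\<in>A. w j *\<^sub>R T (V j)) - T 0"
    using w by (simp add: L_def scaleR_diff_right sum_subtractf flip: scaleR_sum_left)
  finally show ?thesis
    by (simp add: L_def)
qed

lemma associated_center_equivariant:
  assumes f: "center_function n D f"
  shows "equivariant_center n (associated_center_domain n D f) (associated_center n f)"
proof -
  let ?D = "associated_center_domain n D f" and ?X = "associated_center n f"
  have shifted_mem: "shifted n j V \<in> D" if "V \<in> ?D" "j \<in> {1..n}" for V j
    using that unfolding associated_center_domain_def by blast
  have "?X (relabel n \<alpha> V) = ?X V"
    if V: "V \<in> ?D" and \<alpha>: "\<alpha> \<in> dihedral n" and V': "relabel n \<alpha> V \<in> ?D" for V \<alpha>
  proof -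
    obtain \<tau> where perm: "\<alpha> permutes {1..n}" and \<tau>: "\<tau> \<in> {id, sigma n}"
      and comp: "\<And>j. j \<in> {1..n} \<Longrightarrow> \<alpha> \<circ> rho n ^^ (j - 1) = rho n ^^ (\<alpha> j - 1) \<circ> \<tau>"
      using dihedral_comp_rho_funpow[OF \<alpha>] by blast
    have coordinate: "f (shifted n j (relabel n \<alpha> V)) = f (shifted n (\<alpha> j) V)" if j: "j \<in> {1..n}" for j
    proof -
      have "\<alpha> j \<in> {1..n}"
        using j permutes_in_image[OF perm] by blast
      then have mem: "shifted n (\<alpha> j) V \<in> D"
        by (rule shifted_mem[OF V])
      have \<tau>_mem: "\<tau> i \<in> {1..n}" if "i \<in> {1..n}" for i
        using that \<tau> sigma_mem by auto
      \<comment> \<open>Both sides are \<open>V\<close> precomposed with the two forms of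
        \<open>\<alpha> \<circ> rho n ^^ (j - 1)\<close>.\<close>
      have eq: "shifted n j (relabel n \<alpha> V) = relabel n \<tau> (shifted n (\<alpha> j) V)"
        unfolding shifted_def by (simp only: relabel_relabel rho_funpow_mem \<tau>_mem comp[OF j])
      show ?thesis
      proof (cases "\<tau> = id")
        case True
        \<comment> \<open>Relabelling by \<open>id\<close> changes nothing here since a shifted
          n-gon is already extensional.\<close>
        then have "relabel n \<tau> (shifted n (\<alpha> j) V) = shifted n (\<alpha> j) V"
          by (auto simp: shifted_def relabel_def fun_eq_iff)
        then show ?thesis
          unfolding eq by simp
      next
        case False
        then have "\<tau> = sigma n"
          using \<tau> by blast
        \<comment> \<open>The reflection law is guarded by membership in \<open>D\<close> on both
          sides: one comes from \<open>V\<close>, the other, through \<open>eq\<close>, from the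
          relabelled n-gon.\<close>
        then show ?thesis
          using f mem shifted_mem[OF V' j] unfolding eq center_function_def by metis
      qed
    qed
    have "(\<Sum>j=1..n. f (shifted n j (relabel n \<alpha> V))) = (\<Sum>j=1..n. f (shifted n (\<alpha> j) V))"
      by (rule sum.cong) (simp_all only: coordinate)
    also have "\<dots> = (\<Sum>j=1..n. f (shifted n j V))"
      by (rule sum.permute[OF perm, symmetric, unfolded comp_def])
    finally have sum_eq:
      "(\<Sum>j=1..n. f (shifted n j (relabel n \<alpha> V))) = (\<Sum>j=1..n. f (shifted n j V))" .
    have "(\<Sum>j=1..n. f (shifted n j (relabel n \<alpha> V)) *\<^sub>R relabel n \<alpha> V j) =
        (\<Sum>j=1..n. f (shifted n (\<alpha> j) V) *\<^sub>R V (\<alpha> j))"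
      by (rule sum.cong) (simp_all only: coordinate relabel_apply)
    also have "\<dots> = (\<Sum>j=1..n. f (shifted n j V) *\<^sub>R V j)"
      by (rule sum.permute[OF perm, symmetric, unfolded comp_def])
    finally show ?thesis
      by (simp only: associated_center_eq(2)[OF V] associated_center_eq(2)[OF V'] sum_eq)
  qed
  moreover have "?X (scale_ngon n t V) = t *\<^sub>R ?X V"
    if V: "V \<in> ?D" and t: "t \<ge> 0" and V': "scale_ngon n t V \<in> ?D" for V t
  proof -
    obtain k :: nat where k: "\<And>V t. V \<in> D \<Longrightarrow> t \<ge> 0 \<Longrightarrow> scale_ngon n t V \<in> D \<Longrightarrow>
        f (scale_ngon n t V) = t ^ k * f V"
      using f unfolding center_function_def by blast
    have coordinate: "f (shifted n j (scale_ngon n t V)) = t ^ k * f (shifted n j V)"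
      if "j \<in> {1..n}" for j
      using k[OF shifted_mem[OF V that] t] shifted_mem[OF V' that]
      by (simp add: scale_ngon_def shifted_map_ngon)
    have sum_eq: "(\<Sum>j=1..n. f (shifted n j (scale_ngon n t V))) =
        t ^ k * (\<Sum>j=1..n. f (shifted n j V))"
      unfolding sum_distrib_left by (rule sum.cong) (simp_all only: coordinate)
    \<comment> \<open>For \<open>t = 0\<close> this forces \<open>k = 0\<close>: otherwise the center of the scaled \<open>n\<close>-gon is undefined.\<close>
    have "t ^ k \<noteq> 0"
      using associated_center_eq(1)[OF V'] unfolding sum_eq by simp
    moreover have "(\<Sum>j=1..n. f (shifted n j (scale_ngon n t V)) *\<^sub>R scale_ngon n t V j) =
        (t ^ k * t) *\<^sub>R (\<Sum>j=1..n. f (shifted n j V) *\<^sub>R V j)"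
      unfolding scaleR_sum_right
      by (rule sum.cong) (simp_all add: coordinate[unfolded scale_ngon_def] scale_ngon_def map_ngon_apply mult_ac)
    ultimately show ?thesis
      unfolding associated_center_eq(2)[OF V] associated_center_eq(2)[OF V'] sum_eq
      by (simp add: field_simps)
  qed
  moreover have "?X (map_ngon n T V) = T (?X V)"
    if V: "V \<in> ?D" and T: "rigid_motion T" and V': "map_ngon n T V \<in> ?D" for V T
  proof -
    let ?S = "\<Sum>j=1..n. f (shifted n j V)"
    have coordinate: "f (shifted n j (map_ngon n T V)) = f (shifted n j V)" if "j \<in> {1..n}" for j
      using f shifted_mem[OF V that] shifted_mem[OF V' that] T
      by (simp add: center_function_def shifted_map_ngon)
    have "?X (map_ngon n T V) = (\<Sum>j=1..n. f (shifted n j V) *\<^sub>R T (V j)) /\<^sub>R ?S"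
      unfolding associated_center_eq(2)[OF V'] by (simp add: coordinate map_ngon_apply)
    \<comment> \<open>The division moves into the weights because \<open>T\<close> commutes only
      with combinations whose weights sum to 1.\<close>
    also have "\<dots> = (\<Sum>j=1..n. (f (shifted n j V) / ?S) *\<^sub>R T (V j))"
      by (simp add: scaleR_sum_right divide_inverse mult.commute)
    also have "\<dots> = T (\<Sum>j=1..n. (f (shifted n j V) / ?S) *\<^sub>R V j)"
      using associated_center_eq(1)[OF V]
      by (intro rigid_motion_affine[OF T, symmetric]) (simp flip: sum_divide_distrib)
    also have "\<dots> = T (?X V)"
      unfolding associated_center_eq(2)[OF V]
      by (simp add: scaleR_sum_right divide_inverse mult.commute)
    finally show ?thesis .
  qed
  ultimately show ?thesis
    unfolding equivariant_center_def by blast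
qed

theorem theorem24:
  fixes n :: nat
  assumes "n \<ge> 3"
  shows "(\<forall>D X. D \<subseteq> ngons n \<longrightarrow>
            implicit_center TYPE('a::zero) n D X \<longrightarrow> minimal_center n D X) \<and>
         (\<forall>D X. D \<subseteq> ngons n \<longrightarrow>
            minimal_center n D X \<longrightarrow> implicit_center TYPE('b::euclidean_space) n D X) \<and>
         (\<forall>D f. D \<subseteq> ngons n \<longrightarrow> center_function n D f \<longrightarrow>
            implicit_center TYPE('b) n (associated_center_domain n D f) (associated_center n f) \<and>
            minimal_center n (associated_center_domain n D f) (associated_center n f))"
  by (intro conjI allI impI;
      erule equivariant_imp_minimal_center[OF implicit_center_imp_equivariant]
        equivariant_imp_implicit_center[OF minimal_center_imp_equivariant]
        equivariant_imp_implicit_center[OF associated_center_equivariant]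
        equivariant_imp_minimal_center[OF associated_center_equivariant])

end
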